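(* Let $F$ be a field. Let $\mathrm{Alt}$ be the category of alternative algebras over $F$, $\mathrm{gAlt}$ the category of g-alternative algebras over $F$, and $\overline{\mathrm{gAlt}}$ the full subcategory of $\mathrm{gAlt}$ consisting of those g-alternative algebras $A$ satisfying the flexible law $(xy)x=x(yx)$ for all $x,y\in A$. Then: (i) for any field $F$, $\mathrm{Alt}=\overline{\mathrm{gAlt}}$ (i.e. an $F$-algebra is alternative if and only if it is g-alternative and flexible); (ii) if $\operatorname{char}F\neq 2$, then $\mathrm{gAlt}=\overline{\mathrm{gAlt}}=\mathrm{Alt}$.
   Context: An algebra over a field $F$ is an $F$-vector space with an $F$-bilinear multiplication, not assumed associative or unital; morphisms are $F$-algebra homomorphisms. An algebra $A$ is alternative if $x^2y=x(xy)$ and $yx^2=(yx)x$ for all $x,y\in A$. An algebra $A$ is g-alternative if for all $x,y,z\in A$: $x(yz)=(xy)z+(yx)z-y(xz)$ and $(xy)z=x(yz)+x(zy)-(xz)y$. *)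

theory Defs
  imports "HOL-Algebra.Module"
begin

text \<open>
  Algebras are records of type \<open>module\<close>, whose multiplication field carries the
  algebra product. The field \<open>one\<close> of the record is unconstrained and never used
  for an algebra; in particular squares are written as products, because the power
  operation of HOL-Algebra refers to \<open>one\<close>.
\<close>

locale nonassoc_algebra = module F A + field F
  for F (structure) and A (structure) +
  assumes mult_closed:
      "\<lbrakk>x \<in> carrier A; y \<in> carrier A\<rbrakk> \<Longrightarrow> x \<otimes>\<^bsub>A\<^esub> y \<in> carrier A"
    and mult_add_left:
      "\<lbrakk>x \<in> carrier A; y \<in> carrier A; z \<in> carrier A\<rbrakk>
        \<Longrightarrow> (x \<oplus>\<^bsub>A\<^esub> y) \<otimes>\<^bsub>A\<^esub> z = x \<otimes>\<^bsub>A\<^esub> z \<oplus>\<^bsub>A\<^esub> y \<otimes>\<^bsub>A\<^esub> z"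
    and mult_add_right:
      "\<lbrakk>x \<in> carrier A; y \<in> carrier A; z \<in> carrier A\<rbrakk>
        \<Longrightarrow> x \<otimes>\<^bsub>A\<^esub> (y \<oplus>\<^bsub>A\<^esub> z) = x \<otimes>\<^bsub>A\<^esub> y \<oplus>\<^bsub>A\<^esub> x \<otimes>\<^bsub>A\<^esub> z"
    and mult_smult_left:
      "\<lbrakk>a \<in> carrier F; x \<in> carrier A; y \<in> carrier A\<rbrakk>
        \<Longrightarrow> (a \<odot>\<^bsub>A\<^esub> x) \<otimes>\<^bsub>A\<^esub> y = a \<odot>\<^bsub>A\<^esub> (x \<otimes>\<^bsub>A\<^esub> y)"
    and mult_smult_right:
      "\<lbrakk>a \<in> carrier F; x \<in> carrier A; y \<in> carrier A\<rbrakk>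
        \<Longrightarrow> x \<otimes>\<^bsub>A\<^esub> (a \<odot>\<^bsub>A\<^esub> y) = a \<odot>\<^bsub>A\<^esub> (x \<otimes>\<^bsub>A\<^esub> y)"

definition alternative_alg :: "('f, 'a, 'm) module_scheme \<Rightarrow> bool" where
  "alternative_alg A \<longleftrightarrow>
    (\<forall>x\<in>carrier A. \<forall>y\<in>carrier A.
      (x \<otimes>\<^bsub>A\<^esub> x) \<otimes>\<^bsub>A\<^esub> y = x \<otimes>\<^bsub>A\<^esub> (x \<otimes>\<^bsub>A\<^esub> y) \<and>
      y \<otimes>\<^bsub>A\<^esub> (x \<otimes>\<^bsub>A\<^esub> x) = (y \<otimes>\<^bsub>A\<^esub> x) \<otimes>\<^bsub>A\<^esub> x)"

definition g_alternative_alg :: "('f, 'a, 'm) module_scheme \<Rightarrow> bool" where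
  "g_alternative_alg A \<longleftrightarrow>
    (\<forall>x\<in>carrier A. \<forall>y\<in>carrier A. \<forall>z\<in>carrier A.
      x \<otimes>\<^bsub>A\<^esub> (y \<otimes>\<^bsub>A\<^esub> z) =
        ((x \<otimes>\<^bsub>A\<^esub> y) \<otimes>\<^bsub>A\<^esub> z \<oplus>\<^bsub>A\<^esub> (y \<otimes>\<^bsub>A\<^esub> x) \<otimes>\<^bsub>A\<^esub> z)
          \<ominus>\<^bsub>A\<^esub> y \<otimes>\<^bsub>A\<^esub> (x \<otimes>\<^bsub>A\<^esub> z) \<and>
      (x \<otimes>\<^bsub>A\<^esub> y) \<otimes>\<^bsub>A\<^esub> z =
        (x \<otimes>\<^bsub>A\<^esub> (y \<otimes>\<^bsub>A\<^esub> z) \<oplus>\<^bsub>A\<^esub> x \<otimes>\<^bsub>A\<^esub> (z \<otimes>\<^bsub>A\<^esub> y))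
          \<ominus>\<^bsub>A\<^esub> (x \<otimes>\<^bsub>A\<^esub> z) \<otimes>\<^bsub>A\<^esub> y)"

definition flexible_alg :: "('f, 'a, 'm) module_scheme \<Rightarrow> bool" where
  "flexible_alg A \<longleftrightarrow>
    (\<forall>x\<in>carrier A. \<forall>y\<in>carrier A.
      (x \<otimes>\<^bsub>A\<^esub> y) \<otimes>\<^bsub>A\<^esub> x = x \<otimes>\<^bsub>A\<^esub> (y \<otimes>\<^bsub>A\<^esub> x))"

definition ring_char :: "('f, 'r) ring_scheme \<Rightarrow> nat" where
  "ring_char R =
    (if \<exists>n::nat. n > 0 \<and> [n] \<cdot>\<^bsub>R\<^esub> \<one>\<^bsub>R\<^esub> = \<zero>\<^bsub>R\<^esub>
     then LEAST n::nat. n > 0 \<and> [n] \<cdot>\<^bsub>R\<^esub> \<one>\<^bsub>R\<^esub> = \<zero>\<^bsub>R\<^esub>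
     else 0)"

text \<open>
  Homomorphisms are extensional functions (undefined outside the carrier of the
  source), so that equality of morphisms is equality in HOL.
\<close>

definition alg_hom ::
    "('f, 'r) ring_scheme \<Rightarrow> ('f, 'a, 'm) module_scheme \<Rightarrow> ('f, 'b, 'n) module_scheme
      \<Rightarrow> ('a \<Rightarrow> 'b) set" where
  "alg_hom F A B =
    {h \<in> carrier A \<rightarrow>\<^sub>E carrier B.
      (\<forall>x\<in>carrier A. \<forall>y\<in>carrier A. h (x \<oplus>\<^bsub>A\<^esub> y) = h x \<oplus>\<^bsub>B\<^esub> h y) \<and>
      (\<forall>a\<in>carrier F. \<forall>x\<in>carrier A. h (a \<odot>\<^bsub>A\<^esub> x) = a \<odot>\<^bsub>B\<^esub> h x) \<and>
      (\<forall>x\<in>carrier A. \<forall>y\<in>carrier A. h (x \<otimes>\<^bsub>A\<^esub> y) = h x \<otimes>\<^bsub>B\<^esub> h y)}"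

text \<open>
  \<open>Comp C X Y Z g f\<close> is the composite of \<open>f \<in> Hom C X Y\<close> and \<open>g \<in> Hom C Y Z\<close>.
\<close>

record ('o, 'h) cat =
  Ob :: "'o set"
  Hom :: "'o \<Rightarrow> 'o \<Rightarrow> 'h set"
  Id :: "'o \<Rightarrow> 'h"
  Comp :: "'o \<Rightarrow> 'o \<Rightarrow> 'o \<Rightarrow> 'h \<Rightarrow> 'h \<Rightarrow> 'h"

locale category =
  fixes C :: "('o, 'h) cat"
  assumes Id_in_Hom: "X \<in> Ob C \<Longrightarrow> Id C X \<in> Hom C X X"
    and Comp_in_Hom:
      "\<lbrakk>X \<in> Ob C; Y \<in> Ob C; Z \<in> Ob C; f \<in> Hom C X Y; g \<in> Hom C Y Z\<rbrakk>
        \<Longrightarrow> Comp C X Y Z g f \<in> Hom C X Z"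
    and Comp_Id_right:
      "\<lbrakk>X \<in> Ob C; Y \<in> Ob C; f \<in> Hom C X Y\<rbrakk> \<Longrightarrow> Comp C X X Y f (Id C X) = f"
    and Comp_Id_left:
      "\<lbrakk>X \<in> Ob C; Y \<in> Ob C; f \<in> Hom C X Y\<rbrakk> \<Longrightarrow> Comp C X Y Y (Id C Y) f = f"
    and Comp_assoc:
      "\<lbrakk>X \<in> Ob C; Y \<in> Ob C; Z \<in> Ob C; W \<in> Ob C;
        f \<in> Hom C X Y; g \<in> Hom C Y Z; h \<in> Hom C Z W\<rbrakk>
        \<Longrightarrow> Comp C X Y W (Comp C Y Z W h g) f = Comp C X Z W h (Comp C X Y Z g f)"

text \<open>
  Hom-sets between non-objects are normalized to the empty set, so that equality of
  full subcategories in HOL is equality of categories.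
\<close>

definition full_subcat :: "('o, 'h) cat \<Rightarrow> ('o \<Rightarrow> bool) \<Rightarrow> ('o, 'h) cat" where
  "full_subcat C P =
    \<lparr>Ob = {X \<in> Ob C. P X},
     Hom = (\<lambda>X Y. if X \<in> Ob C \<and> P X \<and> Y \<in> Ob C \<and> P Y then Hom C X Y else {}),
     Id = Id C,
     Comp = Comp C\<rparr>"

text \<open>
  The type \<open>'a\<close> plays the role of a universe: the objects are all algebras over \<open>F\<close>
  whose carrier is a set of elements of \<open>'a\<close>.
\<close>

definition Alg_cat ::
    "('f, 'r) ring_scheme \<Rightarrow> (('f, 'a, 'm) module_scheme, 'a \<Rightarrow> 'a) cat" where
  "Alg_cat F =
    \<lparr>Ob = {A. nonassoc_algebra F A},
     Hom = alg_hom F,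
     Id = (\<lambda>A. \<lambda>x\<in>carrier A. x),
     Comp = (\<lambda>A B C g f. compose (carrier A) g f)\<rparr>"

definition Alt_cat ::
    "('f, 'r) ring_scheme \<Rightarrow> (('f, 'a, 'm) module_scheme, 'a \<Rightarrow> 'a) cat" where
  "Alt_cat F = full_subcat (Alg_cat F) alternative_alg"

definition gAlt_cat ::
    "('f, 'r) ring_scheme \<Rightarrow> (('f, 'a, 'm) module_scheme, 'a \<Rightarrow> 'a) cat" where
  "gAlt_cat F = full_subcat (Alg_cat F) g_alternative_alg"

definition gAlt_flex_cat ::
    "('f, 'r) ring_scheme \<Rightarrow> (('f, 'a, 'm) module_scheme, 'a \<Rightarrow> 'a) cat" where
  "gAlt_flex_cat F = full_subcat (gAlt_cat F) flexible_alg"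

lemma category_Alg_cat:
  fixes F :: "('f, 'r) ring_scheme"
  shows "category (Alg_cat F :: (('f, 'a, 'm) module_scheme, 'a \<Rightarrow> 'a) cat)"
proof -
  let ?C = "Alg_cat F :: (('f, 'a, 'm) module_scheme, 'a \<Rightarrow> 'a) cat"
  show ?thesis
  proof
    fix X :: "('f, 'a, 'm) module_scheme"
    assume "X \<in> Ob ?C"
    then interpret nonassoc_algebra F X by (simp add: Alg_cat_def)
    show "Id ?C X \<in> Hom ?C X X"
      by (auto simp: Alg_cat_def alg_hom_def mult_closed)
  next
    fix X Y Z :: "('f, 'a, 'm) module_scheme" and f g
    assume "X \<in> Ob ?C" and *: "f \<in> Hom ?C X Y" "g \<in> Hom ?C Y Z"
    then interpret nonassoc_algebra F X by (simp add: Alg_cat_def)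
    show "Comp ?C X Y Z g f \<in> Hom ?C X Z"
      using * by (auto simp: Alg_cat_def alg_hom_def mult_closed compose_eq PiE_def Pi_def)
  next
    fix X Y :: "('f, 'a, 'm) module_scheme" and f
    assume "f \<in> Hom ?C X Y"
    then have "f \<in> carrier X \<rightarrow>\<^sub>E carrier Y" by (simp add: Alg_cat_def alg_hom_def)
    then show "Comp ?C X X Y f (Id ?C X) = f"
      and "Comp ?C X Y Y (Id ?C Y) f = f"
      by (auto simp: Alg_cat_def compose_Id Id_compose PiE_def)
  next
    fix X Y Z W :: "('f, 'a, 'm) module_scheme" and f g h
    assume "f \<in> Hom ?C X Y"
    then have "f \<in> carrier X \<rightarrow> carrier Y" by (simp add: Alg_cat_def alg_hom_def PiE_def)
    then show "Comp ?C X Y W (Comp ?C Y Z W h g) f =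
        Comp ?C X Z W h (Comp ?C X Y Z g f)"
      by (auto simp: Alg_cat_def compose_def fun_eq_iff)
  qed
qed

lemma category_full_subcat:
  assumes "category C" shows "category (full_subcat C P)"
proof -
  interpret category C by fact
  show ?thesis
    by unfold_locales
      (auto simp: full_subcat_def Id_in_Hom Comp_Id_left Comp_Id_right Comp_assoc
        intro: Comp_in_Hom split: if_splits)
qed

end

theory Submission
  imports Defs
begin

text \<open>
  In terms of the associator \<open>(x, y, z) = (xy)z - x(yz)\<close>, g-alternativity says that it is
  skew-symmetric in the first two and in the last two arguments. Linearizing the alternative laws
  gives this skew-symmetry, whence \<open>(x, y, x) = -(x, x, y) = 0\<close>; the same identity
  read backwards derives the alternative laws from flexibility. Skew-symmetry alone gives
  \<open>2 (x, x, y) = 0\<close>, which suffices in characteristic other than \<open>2\<close>.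
\<close>

context abelian_group
begin

text \<open>Serves to move the subtracted product of each g-alternative identity to the other side,
  where it can be compared with a sum of associators.\<close>

lemma eq_add_minus_iff:
  assumes "a \<in> carrier G" "b \<in> carrier G" "c \<in> carrier G" "d \<in> carrier G"
  shows "a = (b \<oplus> c) \<ominus> d \<longleftrightarrow> a \<oplus> d = b \<oplus> c"
  using assms by (metis a_minus_def add.inv_solve_right add.m_closed)

lemma minus_eq_zero_iff:
  assumes "a \<in> carrier G" "b \<in> carrier G"
  shows "a \<ominus> b = \<zero> \<longleftrightarrow> a = b"
  using assms by (simp add: a_minus_def add.inv_solve_right')

lemma minus_add_minus:
  assumes "a \<in> carrier G" "b \<in> carrier G" "c \<in> carrier G" "d \<in> carrier G"
  shows "(a \<ominus> b) \<oplus> (c \<ominus> d) = (a \<oplus> c) \<ominus> (b \<oplus> d)"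
  using assms by (simp add: a_minus_def minus_add a_ac)

end

context nonassoc_algebra
begin

definition associator :: "_ \<Rightarrow> _ \<Rightarrow> _ \<Rightarrow> _" where
  "associator x y z = (x \<otimes>\<^bsub>A\<^esub> y) \<otimes>\<^bsub>A\<^esub> z \<ominus>\<^bsub>A\<^esub> x \<otimes>\<^bsub>A\<^esub> (y \<otimes>\<^bsub>A\<^esub> z)"

lemma associator_closed [simp, intro]:
  assumes "x \<in> carrier A" "y \<in> carrier A" "z \<in> carrier A"
  shows "associator x y z \<in> carrier A"
  using assms by (simp add: associator_def mult_closed)

text \<open>Additivity in each of the three arguments is what polarizing the alternative laws relies
  on.\<close>

lemma associator_add_1:
  assumes "x \<in> carrier A" "x' \<in> carrier A" "y \<in> carrier A" "z \<in> carrier A"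
  shows "associator (x \<oplus>\<^bsub>A\<^esub> x') y z = associator x y z \<oplus>\<^bsub>A\<^esub> associator x' y z"
  using assms
  by (simp add: associator_def mult_closed mult_add_left M.minus_add_minus)

lemma associator_add_2:
  assumes "x \<in> carrier A" "y \<in> carrier A" "y' \<in> carrier A" "z \<in> carrier A"
  shows "associator x (y \<oplus>\<^bsub>A\<^esub> y') z = associator x y z \<oplus>\<^bsub>A\<^esub> associator x y' z"
  using assms
  by (simp add: associator_def mult_closed mult_add_left mult_add_right M.minus_add_minus)

lemma associator_add_3:
  assumes "x \<in> carrier A" "y \<in> carrier A" "z \<in> carrier A" "z' \<in> carrier A"
  shows "associator x y (z \<oplus>\<^bsub>A\<^esub> z') = associator x y z \<oplus>\<^bsub>A\<^esub> associator x y z'"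
  using assms
  by (simp add: associator_def mult_closed mult_add_right M.minus_add_minus)

lemma alternative_iff_associator:
  "alternative_alg A \<longleftrightarrow>
    (\<forall>x\<in>carrier A. \<forall>y\<in>carrier A. associator x x y = \<zero>\<^bsub>A\<^esub> \<and> associator y x x = \<zero>\<^bsub>A\<^esub>)"
  unfolding alternative_alg_def
  by (intro ball_cong refl)
    (auto simp: associator_def mult_closed M.minus_eq_zero_iff)

lemma flexible_iff_associator:
  "flexible_alg A \<longleftrightarrow> (\<forall>x\<in>carrier A. \<forall>y\<in>carrier A. associator x y x = \<zero>\<^bsub>A\<^esub>)"
  unfolding flexible_alg_def
  by (intro ball_cong refl) (simp add: associator_def mult_closed M.minus_eq_zero_iff)

text \<open>Once subtraction is cleared, the first identity reads
  \<open>(xy)z + (yx)z = x(yz) + y(xz)\<close> and the second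
  \<open>(xy)z + (xz)y = x(yz) + x(zy)\<close>; each says that a sum of two associators
  vanishes.\<close>

lemma g_alternative_iff_associator:
  "g_alternative_alg A \<longleftrightarrow>
    (\<forall>x\<in>carrier A. \<forall>y\<in>carrier A. \<forall>z\<in>carrier A.
      associator x y z \<oplus>\<^bsub>A\<^esub> associator y x z = \<zero>\<^bsub>A\<^esub> \<and>
      associator x y z \<oplus>\<^bsub>A\<^esub> associator x z y = \<zero>\<^bsub>A\<^esub>)"
  unfolding g_alternative_alg_def
  by (intro ball_cong refl)
    (auto simp: associator_def mult_closed M.minus_add_minus M.minus_eq_zero_iff
      M.eq_add_minus_iff)

lemma alternative_imp_g_alternative:
  assumes "alternative_alg A"
  shows "g_alternative_alg A"
  unfolding g_alternative_iff_associator
proof (intro ballI conjI)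
  fix x y z
  assume xyz: "x \<in> carrier A" "y \<in> carrier A" "z \<in> carrier A"
  have alt: "associator u u v = \<zero>\<^bsub>A\<^esub>" "associator v u u = \<zero>\<^bsub>A\<^esub>"
    if "u \<in> carrier A" "v \<in> carrier A" for u v
    using assms that by (auto simp: alternative_iff_associator)
  \<comment> \<open>Polarization: of the four terms of the expansion, \<open>(x, x, z)\<close> and
    \<open>(y, y, z)\<close> vanish, while the left side is zero by the alternative law at
    \<open>x + y\<close>.\<close>
  have "associator (x \<oplus>\<^bsub>A\<^esub> y) (x \<oplus>\<^bsub>A\<^esub> y) z = associator y x z \<oplus>\<^bsub>A\<^esub> associator x y z"
    using xyz by (simp add: associator_add_1 associator_add_2 alt(1)[OF xyz(1,3)] alt(1)[OF xyz(2,3)])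
  then show "associator x y z \<oplus>\<^bsub>A\<^esub> associator y x z = \<zero>\<^bsub>A\<^esub>"
    using xyz alt(1)[of "x \<oplus>\<^bsub>A\<^esub> y" z] by (simp add: M.a_comm)
  have "associator x (y \<oplus>\<^bsub>A\<^esub> z) (y \<oplus>\<^bsub>A\<^esub> z) = associator x z y \<oplus>\<^bsub>A\<^esub> associator x y z"
    using xyz by (simp add: associator_add_2 associator_add_3 alt(2)[OF xyz(2,1)] alt(2)[OF xyz(3,1)])
  then show "associator x y z \<oplus>\<^bsub>A\<^esub> associator x z y = \<zero>\<^bsub>A\<^esub>"
    using xyz alt(2)[of "y \<oplus>\<^bsub>A\<^esub> z" x] by (simp add: M.a_comm)
qed

lemma g_alternative_imp_alternative_iff_flexible:
  assumes "g_alternative_alg A"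
  shows "alternative_alg A \<longleftrightarrow> flexible_alg A"
proof -
  \<comment> \<open>Skew-symmetry in the last two arguments at \<open>(x, x, y)\<close>, then in the
    first two at \<open>(x, y, x)\<close>. Hence \<open>(x, x, y)\<close> and
    \<open>(y, x, x)\<close> both equal \<open>-(x, y, x)\<close>, in any characteristic.\<close>
  have "associator x x y \<oplus>\<^bsub>A\<^esub> associator x y x = \<zero>\<^bsub>A\<^esub>"
    and "associator x y x \<oplus>\<^bsub>A\<^esub> associator y x x = \<zero>\<^bsub>A\<^esub>"
    if "x \<in> carrier A" "y \<in> carrier A" for x y
    using assms that by (auto simp: g_alternative_iff_associator)
  then show ?thesis
    unfolding alternative_iff_associator flexible_iff_associator
    by (metis M.l_zero M.r_zero associator_closed)
qed

lemma alternative_iff_g_alternative_flexible: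
  "alternative_alg A \<longleftrightarrow> g_alternative_alg A \<and> flexible_alg A"
  using alternative_imp_g_alternative g_alternative_imp_alternative_iff_flexible by blast

text \<open>The scalar \<open>1 + 1\<close> is a unit of the field, so multiplying
  \<open>(1 + 1) a = 0\<close> by its inverse recovers \<open>a = 0\<close>.\<close>

lemma double_eq_zeroD:
  assumes "\<one> \<oplus> \<one> \<noteq> \<zero>" "a \<in> carrier A" "a \<oplus>\<^bsub>A\<^esub> a = \<zero>\<^bsub>A\<^esub>"
  shows "a = \<zero>\<^bsub>A\<^esub>"
proof -
  have two: "(\<one> \<oplus> \<one>) \<odot>\<^bsub>A\<^esub> a = \<zero>\<^bsub>A\<^esub>"
    using assms by (simp add: smult_l_distr)
  have unit: "\<one> \<oplus> \<one> \<in> Units F"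
    using assms by (simp add: field_Units)
  have "a = (inv (\<one> \<oplus> \<one>) \<otimes> (\<one> \<oplus> \<one>)) \<odot>\<^bsub>A\<^esub> a"
    using assms unit by (simp only: Units_l_inv smult_one)
  also have "\<dots> = inv (\<one> \<oplus> \<one>) \<odot>\<^bsub>A\<^esub> ((\<one> \<oplus> \<one>) \<odot>\<^bsub>A\<^esub> a)"
    using assms unit by (intro smult_assoc1) auto
  also have "\<dots> = \<zero>\<^bsub>A\<^esub>"
    using unit by (simp only: two smult_r_null Units_inv_closed)
  finally show ?thesis .
qed

lemma g_alternative_imp_alternative:
  assumes "\<one> \<oplus> \<one> \<noteq> \<zero>" "g_alternative_alg A"
  shows "alternative_alg A"
  unfolding alternative_iff_associator
proof (intro ballI conjI)
  fix x y
  assume xy: "x \<in> carrier A" "y \<in> carrier A"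
  \<comment> \<open>Swapping two equal arguments leaves an associator unchanged, so skew-symmetry
    makes its double vanish.\<close>
  have "associator x x y \<oplus>\<^bsub>A\<^esub> associator x x y = \<zero>\<^bsub>A\<^esub>"
    and "associator y x x \<oplus>\<^bsub>A\<^esub> associator y x x = \<zero>\<^bsub>A\<^esub>"
    using assms(2) xy by (auto simp: g_alternative_iff_associator)
  then show "associator x x y = \<zero>\<^bsub>A\<^esub>" "associator y x x = \<zero>\<^bsub>A\<^esub>"
    using double_eq_zeroD[OF assms(1)] xy by blast+
qed

end

lemma (in field) two_eq_zero_imp_ring_char:
  assumes "\<one> \<oplus> \<one> = \<zero>"
  shows "ring_char R = 2"
proof -
  have two: "[(2::nat)] \<cdot> \<one> = \<zero>"
    using assms by (simp add: numeral_2_eq_2)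
  have "(LEAST n::nat. n > 0 \<and> [n] \<cdot> \<one> = \<zero>) = 2"
  proof (rule Least_equality)
    fix n :: nat
    assume n: "n > 0 \<and> [n] \<cdot> \<one> = \<zero>"
    \<comment> \<open>\<open>n = 1\<close> would give \<open>\<one> = \<zero>\<close>, which is
      impossible in a field.\<close>
    then have "n \<noteq> 1" by auto
    with n show "2 \<le> n" by linarith
  qed (simp add: two)
  then show ?thesis
    using two unfolding ring_char_def by (metis zero_less_numeral)
qed

text \<open>Equality is literal because Hom-sets between non-objects are empty on both
  sides.\<close>

lemma full_subcat_full_subcat:
  "full_subcat (full_subcat C P) Q = full_subcat C (\<lambda>X. P X \<and> Q X)"
  by (auto simp: full_subcat_def fun_eq_iff)

text \<open>Turns an equivalence of predicates that holds for algebras into an equality of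
  categories.\<close>

lemma full_subcat_cong:
  assumes "\<And>X. X \<in> Ob C \<Longrightarrow> P X \<longleftrightarrow> Q X"
  shows "full_subcat C P = full_subcat C Q"
  using assms by (auto simp: full_subcat_def fun_eq_iff)

theorem proposition2p8:
  fixes F :: "('f, 'r) ring_scheme"
  assumes "field F"
  shows "((Alt_cat F :: (('f, 'a, 'm) module_scheme, 'a \<Rightarrow> 'a) cat) = gAlt_flex_cat F \<and>
          (\<forall>A :: ('f, 'a, 'm) module_scheme. nonassoc_algebra F A \<longrightarrow>
            (alternative_alg A \<longleftrightarrow> g_alternative_alg A \<and> flexible_alg A))) \<and>
         (ring_char F \<noteq> 2 \<longrightarrow>
          (gAlt_cat F :: (('f, 'a, 'm) module_scheme, 'a \<Rightarrow> 'a) cat) = gAlt_flex_cat F \<and>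
          (gAlt_flex_cat F :: (('f, 'a, 'm) module_scheme, 'a \<Rightarrow> 'a) cat) = Alt_cat F)"
proof -
  let ?C = "Alg_cat F :: (('f, 'a, 'm) module_scheme, 'a \<Rightarrow> 'a) cat"
  note iff = nonassoc_algebra.alternative_iff_g_alternative_flexible
  have Ob: "nonassoc_algebra F A" if "A \<in> Ob ?C" for A
    using that by (simp add: Alg_cat_def)
  \<comment> \<open>All three categories are brought to one normal form, the same full subcategory
    of \<open>Alg_cat F\<close>.\<close>
  have flex: "gAlt_flex_cat F = full_subcat ?C (\<lambda>A. g_alternative_alg A \<and> flexible_alg A)"
    by (simp add: gAlt_flex_cat_def gAlt_cat_def full_subcat_full_subcat)
  have i: "Alt_cat F = full_subcat ?C (\<lambda>A. g_alternative_alg A \<and> flexible_alg A)"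
    unfolding Alt_cat_def by (intro full_subcat_cong iff[of F]) (rule Ob)
  have ii: "gAlt_cat F = full_subcat ?C (\<lambda>A. g_alternative_alg A \<and> flexible_alg A)"
    if "ring_char F \<noteq> 2"
    unfolding gAlt_cat_def
  proof (intro full_subcat_cong)
    fix A :: "('f, 'a, 'm) module_scheme"
    assume "A \<in> Ob ?C"
    then have A: "nonassoc_algebra F A" by (rule Ob)
    have "\<one>\<^bsub>F\<^esub> \<oplus>\<^bsub>F\<^esub> \<one>\<^bsub>F\<^esub> \<noteq> \<zero>\<^bsub>F\<^esub>"
      using field.two_eq_zero_imp_ring_char[OF assms] that by blast
    then show "g_alternative_alg A \<longleftrightarrow> g_alternative_alg A \<and> flexible_alg A"
      using nonassoc_algebra.g_alternative_imp_alternative[OF A] iff[OF A] by blast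
  qed
  show ?thesis
    using i ii flex iff by metis
qed

end
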